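(* Let $d\in\{2,7,11,19,43,67,163\}$, let $K=\mathbb{Q}(\sqrt{-d})$ (an imaginary quadratic field of class number $1$ with $d\neq 1,3$), and let $L_{\mathfrak{o}}\subset\mathbb{R}^2$ be the lattice obtained from the ring of integers $\mathcal{O}_K$ via the identification $\mathbb{C}\cong\mathbb{R}^2$, $a+bi\mapsto(a,b)$. Then for every $m>0$ for which the shell $(L_{\mathfrak{o}})_m=\{x\in L_{\mathfrak{o}} : (x,x)=m\}$ is nonempty, $(L_{\mathfrak{o}})_m$ is not a spherical $2$-design.
   Context: Here $(\cdot,\cdot)$ is the standard Euclidean inner product on $\mathbb{R}^2$; for $x\in\mathcal{O}_K$ one has $(x,x)=|x|^2=N_{K/\mathbb{Q}}(x)$. Concretely $\mathcal{O}_K=\mathbb{Z}+\mathbb{Z}\sqrt{-d}$ if $-d\equiv 2,3\pmod 4$ and $\mathcal{O}_K=\mathbb{Z}+\mathbb{Z}\frac{-1+\sqrt{-d}}{2}$ if $-d\equiv 1\pmod 4$. A finite nonempty subset $X$ of the sphere $S^{n-1}(r)=\{x\in\mathbb{R}^n:(x,x)=r^2\}$ is a spherical $t$-design if $\frac{1}{|X|}\sum_{x\in X}f(x)=\frac{1}{|S^{n-1}(r)|}\int_{S^{n-1}(r)}f\,d\sigma$ for every polynomial $f$ on $\mathbb{R}^n$ of degree at most $t$. *)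

theory Defs
  imports "HOL-Analysis.Analysis"
begin

definition imag_quadratic_field :: "nat \<Rightarrow> complex set" where
  "imag_quadratic_field d = {a + b * csqrt (- of_nat d) | a b. a \<in> \<rat> \<and> b \<in> \<rat>}"

definition ring_of_integers :: "complex set \<Rightarrow> complex set" where
  "ring_of_integers K = {z \<in> K. algebraic_int z}"

definition complex_to_R2 :: "complex \<Rightarrow> real ^ 2" where
  "complex_to_R2 z = vector [Re z, Im z]"

definition integer_lattice :: "nat \<Rightarrow> (real ^ 2) set" where
  "integer_lattice d = complex_to_R2 ` ring_of_integers (imag_quadratic_field d)"

definition shell :: "'a::real_inner set \<Rightarrow> real \<Rightarrow> 'a set" where
  "shell L m = {x \<in> L. x \<bullet> x = m}"

definition polynomial_of_degree_le :: "nat \<Rightarrow> (real ^ 'n \<Rightarrow> real) \<Rightarrow> bool" where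
  "polynomial_of_degree_le t f \<longleftrightarrow>
     (\<exists>c :: ('n \<Rightarrow> nat) \<Rightarrow> real. \<forall>x.
        f x = (\<Sum>\<alpha> | (\<Sum>i\<in>UNIV. \<alpha> i) \<le> t. c \<alpha> * (\<Prod>i\<in>UNIV. (x $ i) ^ \<alpha> i)))"

text \<open>The index set of the sum above is finite, so the sum is not the default value 0.\<close>

lemma finite_exponents: "finite {\<alpha> :: 'n::finite \<Rightarrow> nat. (\<Sum>i\<in>UNIV. \<alpha> i) \<le> t}"
proof (rule finite_subset)
  show "{\<alpha> :: 'n \<Rightarrow> nat. (\<Sum>i\<in>UNIV. \<alpha> i) \<le> t} \<subseteq> (UNIV :: 'n set) \<rightarrow>\<^sub>E {..t}"
    using order_trans[OF member_le_sum[where A = "UNIV :: 'n set"]] by fastforce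
  show "finite ((UNIV :: 'n set) \<rightarrow>\<^sub>E {..t})"
    by (intro finite_PiE) auto
qed

text \<open>
  The surface measure \<open>\<sigma>\<close> on the sphere of radius \<open>r > 0\<close> in \<open>n\<close>-dimensional space, as a Borel
  measure on the whole space that is concentrated on the sphere:
  \<open>\<sigma>(A) = (n / r) * vol {s x | 0 < s < 1, x \<in> A}\<close> for Borel subsets \<open>A\<close> of the sphere.
  This is the measure for which integration in polar coordinates holds. Its value on the
  whole sphere is computed in \<open>measure_surface_measure_sphere\<close>.
\<close>

definition surface_measure :: "real \<Rightarrow> 'a::euclidean_space measure" where
  "surface_measure r =
     scale_measure (ennreal (real DIM('a) / r))
       (distr (restrict_space lborel (ball 0 r - {0})) borel (\<lambda>x. (r / norm x) *\<^sub>R x))"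

lemma emeasure_surface_measure:
  fixes A :: "'a::euclidean_space set"
  assumes "A \<in> sets borel"
  shows "emeasure (surface_measure r) A =
    ennreal (real DIM('a) / r) *
      emeasure lborel {x \<in> ball 0 r - {0}. (r / norm x) *\<^sub>R x \<in> A}"
proof -
  have m: "(\<lambda>x::'a. (r / norm x) *\<^sub>R x) \<in> borel_measurable (restrict_space lborel (ball 0 r - {0}))"
    by (intro measurable_restrict_space1) measurable
  have "emeasure (surface_measure r) A = ennreal (real DIM('a) / r) *
     emeasure (restrict_space lborel (ball 0 r - {0}))
       {x \<in> ball 0 r - {0}. (r / norm x) *\<^sub>R x \<in> A}"
    using assms
    by (simp add: surface_measure_def emeasure_distr[OF m] vimage_def Int_def
        space_restrict_space conj_commute)
  also have "emeasure (restrict_space lborel (ball 0 r - {0}))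
       {x \<in> ball 0 r - {0}. (r / norm x) *\<^sub>R x \<in> A} =
     emeasure lborel {x \<in> ball 0 r - {0}. (r / norm x) *\<^sub>R x \<in> A}"
    by (rule emeasure_restrict_space) auto
  finally show ?thesis .
qed

lemma measure_surface_measure_sphere:
  assumes "r > 0"
  shows "measure (surface_measure r) (sphere (0::'a::euclidean_space) r) =
    real DIM('a) * unit_ball_vol (real DIM('a)) * r ^ (DIM('a) - 1)"
proof -
  have eq: "{x \<in> ball 0 r - {0}. (r / norm x) *\<^sub>R x \<in> sphere (0::'a) r} = ball 0 r - {0}"
    using assms by auto
  have "emeasure lborel (ball (0::'a) r - {0}) = emeasure lborel (ball (0::'a) r)"
    using assms by (subst emeasure_Diff) auto
  also have "\<dots> = ennreal (unit_ball_vol (real DIM('a)) * r ^ DIM('a))"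
    using assms by (simp add: emeasure_ball)
  finally have "emeasure (surface_measure r) (sphere (0::'a) r) =
      ennreal (real DIM('a) / r * (unit_ball_vol (real DIM('a)) * r ^ DIM('a)))"
    using assms by (subst emeasure_surface_measure, simp, unfold eq) (simp only: ennreal_mult'[symmetric] zero_le_divide_iff of_nat_0_le_iff less_imp_le simp_thms)
  moreover have "real DIM('a) / r * (unit_ball_vol (real DIM('a)) * r ^ DIM('a)) =
      real DIM('a) * unit_ball_vol (real DIM('a)) * r ^ (DIM('a) - 1)"
    using assms by (cases "DIM('a)") (simp_all add: field_simps)
  ultimately show ?thesis
    using assms by (simp add: measure_def)
qed

definition spherical_design :: "nat \<Rightarrow> (real ^ 'n) set \<Rightarrow> bool" where
  "spherical_design t X \<longleftrightarrow>
     finite X \<and> X \<noteq> {} \<and>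
     (\<exists>r > 0. X \<subseteq> sphere 0 r \<and>
        (\<forall>f. polynomial_of_degree_le t f \<longrightarrow>
           1 / real (card X) * (\<Sum>x\<in>X. f x) =
           1 / measure (surface_measure r :: (real ^ 'n) measure) (sphere 0 r) *
             (LINT x:sphere 0 r|surface_measure r. f x)))"

end

theory Submission
  imports Defs "HOL-Number_Theory.Cong" "HOL-Computational_Algebra.Polynomial_Factorial"
begin

text \<open>
  The polynomial \<open>x\<^sub>1\<^sup>2 - x\<^sub>2\<^sup>2\<close> has integral \<open>0\<close> over a circle, so a shell that is a 2-design satisfies
  \<open>A(m) = (\<Sum>z. z\<^sup>2) = 0\<close>, where \<open>z\<close> runs over the integers of \<open>K\<close> of norm \<open>m\<close>. But \<open>A(m) \<noteq> 0\<close>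
  whenever the shell is nonempty, by induction on \<open>m\<close>. Let \<open>p\<close> be a prime divisor of \<open>m\<close>. If \<open>p\<close> is
  not a norm, then class number one makes it inert and \<open>A(p\<^sup>2 n) = p\<^sup>2 A(n)\<close>. If \<open>p\<close> is the norm of
  \<open>\<pi>\<close> and \<open>\<pi>\<close> divides its conjugate, then \<open>A(p n) = \<pi>\<^sup>2 A(n)\<close>. Otherwise put \<open>\<alpha> = \<pi>\<^sup>2\<close> and let
  \<open>\<beta>\<close> be its conjugate. The Hecke recursion \<open>A(p\<^sup>2 n) = (\<alpha> + \<beta>) A(p n) - \<alpha> \<beta> A(n)\<close> gives
  \<open>(\<alpha> - \<beta>) A(p\<^sup>k n) = (\<alpha>\<^sup>k\<^sup>+\<^sup>1 - \<beta>\<^sup>k\<^sup>+\<^sup>1) A(n)\<close> for \<open>n\<close> prime to \<open>p\<close>, and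
  \<open>\<alpha>\<^sup>k\<^sup>+\<^sup>1 \<noteq> \<beta>\<^sup>k\<^sup>+\<^sup>1\<close> because \<open>\<pi>\<close> is a prime element that does not divide its conjugate.
\<close>

section \<open>Imaginary quadratic orders\<close>

text \<open>The norm of x + y \<omega> for a root \<omega> of X^2 - t X + q, hence a binary
  quadratic form of discriminant t^2 - 4 q.\<close>

definition norm_form :: "int \<Rightarrow> int \<Rightarrow> int \<Rightarrow> int \<Rightarrow> int" where
  "norm_form t q x y = x^2 + t * x * y + q * y^2"

locale imaginary_quadratic_order =
  fixes t q :: int
  assumes disc_neg: "t^2 < 4 * q"
begin

text \<open>The root of X^2 - t X + q in the upper half plane. The traces t = 0 and t = 1 cover both
  shapes of the ring of integers; for t = 1 and d = 4 q - 1 it is (1 + sqrt(-d)) / 2, which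
  generates the same ring as (-1 + sqrt(-d)) / 2.\<close>

definition \<omega> :: complex where
  "\<omega> = Complex (t / 2) (sqrt (4 * q - t^2) / 2)"

definition quad_order :: "complex set" where
  "quad_order = {of_int x + of_int y * \<omega> | x y. True}"

definition order_dvd :: "complex \<Rightarrow> complex \<Rightarrow> bool" (infix "dvd\<^sub>o" 50) where
  "a dvd\<^sub>o b \<longleftrightarrow> (\<exists>c\<in>quad_order. b = a * c)"

definition norm_shell :: "nat \<Rightarrow> complex set" where
  "norm_shell n = {z \<in> quad_order. (cmod z)^2 = real n}"

text \<open>The coefficient at n of the theta series of the lattice weighted by the harmonic
  polynomial z^2.\<close>

definition square_sum :: "nat \<Rightarrow> complex" where
  "square_sum n = (\<Sum>z\<in>norm_shell n. z^2)"

section \<open>Ring structure, conjugation and norm\<close>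

lemma omega_square: "\<omega>^2 = of_int t * \<omega> - of_int q"
proof -
  have "real_of_int (t^2) \<le> real_of_int (4 * q)" using disc_neg by linarith
  then have "(sqrt (4 * q - t^2))^2 = 4 * q - t^2" by simp
  then show ?thesis
    by (simp add: complex_eq_iff \<omega>_def power2_eq_square field_simps)
qed

lemma cnj_omega: "cnj \<omega> = of_int t - \<omega>"
  by (simp add: complex_eq_iff \<omega>_def)

lemma cmod_order: "(cmod (of_int x + of_int y * \<omega>))^2 = of_int (norm_form t q x y)"
proof -
  have "complex_of_real ((cmod (of_int x + of_int y * \<omega>))^2)
      = (of_int x + of_int y * \<omega>) * (of_int x + of_int y * (of_int t - \<omega>))"
    by (simp add: complex_norm_square cnj_omega flip: of_real_power)
  also have "\<dots> = of_int x^2 + of_int x * of_int y * of_int t + of_int y^2 * (of_int t * \<omega> - \<omega>^2)"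
    by (simp add: power2_eq_square algebra_simps)
  also have "\<dots> = complex_of_real (of_int (norm_form t q x y))"
    by (simp add: omega_square norm_form_def algebra_simps)
  finally show ?thesis using of_real_eq_iff by blast
qed

lemma quad_orderE:
  assumes "z \<in> quad_order"
  obtains x y where "z = of_int x + of_int y * \<omega>"
  using assms by (auto simp: quad_order_def)

lemma of_int_in_quad_order [simp, intro]: "of_int n \<in> quad_order"
proof -
  have "of_int n = of_int n + of_int 0 * \<omega>" by simp
  then show ?thesis unfolding quad_order_def by blast
qed

lemma of_nat_in_quad_order [simp, intro]: "of_nat n \<in> quad_order"
  using of_int_in_quad_order[of "int n"] by simp

lemma omega_in_quad_order [simp, intro]: "\<omega> \<in> quad_order"
proof -
  have "\<omega> = of_int 0 + of_int 1 * \<omega>" by simp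
  then show ?thesis unfolding quad_order_def by blast
qed

lemma add_in_quad_order [intro]:
  assumes "z \<in> quad_order" "w \<in> quad_order"
  shows "z + w \<in> quad_order"
proof -
  from assms obtain a b c e where "z = of_int a + of_int b * \<omega>" "w = of_int c + of_int e * \<omega>"
    by (auto elim!: quad_orderE)
  then have "z + w = of_int (a + c) + of_int (b + e) * \<omega>" by (simp add: algebra_simps)
  then show ?thesis unfolding quad_order_def by blast
qed

lemma mult_in_quad_order [intro]:
  assumes "z \<in> quad_order" "w \<in> quad_order"
  shows "z * w \<in> quad_order"
proof -
  from assms obtain a b c e where "z = of_int a + of_int b * \<omega>" "w = of_int c + of_int e * \<omega>"
    by (auto elim!: quad_orderE)
  then have "z * w = of_int a * of_int c + (of_int a * of_int e + of_int b * of_int c) * \<omega>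
      + of_int b * of_int e * \<omega>^2"
    by (simp add: algebra_simps power2_eq_square)
  also have "\<dots> = of_int (a * c - b * e * q) + of_int (a * e + b * c + b * e * t) * \<omega>"
    by (simp add: algebra_simps omega_square)
  finally show ?thesis unfolding quad_order_def by blast
qed

lemma minus_in_quad_order [intro]: "z \<in> quad_order \<Longrightarrow> - z \<in> quad_order"
  using mult_in_quad_order[of "of_int (- 1)" z] of_int_in_quad_order by fastforce

lemma diff_in_quad_order [intro]: "z \<in> quad_order \<Longrightarrow> w \<in> quad_order \<Longrightarrow> z - w \<in> quad_order"
  using add_in_quad_order[of z "- w"] minus_in_quad_order by auto

lemma cnj_in_quad_order [intro]:
  assumes "z \<in> quad_order"
  shows "cnj z \<in> quad_order"
proof -
  from assms obtain x y where "z = of_int x + of_int y * \<omega>" by (rule quad_orderE)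
  then have "cnj z = of_int (x + t * y) + of_int (- y) * \<omega>"
    by (simp add: cnj_omega algebra_simps)
  then show ?thesis unfolding quad_order_def by blast
qed

lemma norm_form_nonneg: "norm_form t q x y \<ge> 0"
  using cmod_order[of x y] by (metis of_int_0_le_iff zero_le_power2)

lemma cmod_order_nat:
  assumes "z \<in> quad_order"
  obtains n where "(cmod z)^2 = real n"
proof -
  from assms obtain x y where "z = of_int x + of_int y * \<omega>" by (rule quad_orderE)
  then have "(cmod z)^2 = real (nat (norm_form t q x y))"
    using cmod_order norm_form_nonneg[of x y] by simp
  then show ?thesis by (rule that)
qed

text \<open>Completing the square in either variable. As 4 q - t^2 > 0, the first identity bounds y
  by the norm and the second bounds x.\<close>

lemma norm_form_eq_square_plus:
  "4 * norm_form t q x y = (2 * x + t * y)^2 + (4 * q - t^2) * y^2"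
  "4 * q * norm_form t q x y = (2 * q * y + t * x)^2 + (4 * q - t^2) * x^2"
  by (simp_all add: norm_form_def power2_eq_square algebra_simps)

lemma finite_norm_shell [simp]: "finite (norm_shell n)"
proof (rule finite_subset)
  let ?B = "{- (4 * q * int n)..4 * q * int n} \<times> {- (4 * int n)..4 * int n}"
  show "norm_shell n \<subseteq> (\<lambda>(x, y). of_int x + of_int y * \<omega>) ` ?B"
  proof
    fix z assume z: "z \<in> norm_shell n"
    then obtain x y where xy: "z = of_int x + of_int y * \<omega>"
      by (auto simp: norm_shell_def elim: quad_orderE)
    then have "norm_form t q x y = int n"
      using z cmod_order[of x y] by (simp add: norm_shell_def)
    \<comment> \<open>Integers satisfy \<bar>u\<bar> \<le> u^2, and the integer 4 q - t^2 is at
      least 1.\<close>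
    moreover have sq: "\<bar>u\<bar> \<le> v" if "v = s^2 + (4 * q - t^2) * u^2" for u v s :: int
    proof -
      have "\<bar>u\<bar> \<le> u^2"
        by (metis abs_ge_zero abs_le_square_iff int_one_le_iff_zero_less linorder_not_less mult_left_mono mult.right_neutral order_le_less power2_abs power2_eq_square zero_power2 abs_0)
      also have "\<dots> = 1 * u^2" by simp
      also have "\<dots> \<le> (4 * q - t^2) * u^2"
        using disc_neg by (intro mult_right_mono) auto
      also have "\<dots> \<le> v" using that by simp
      finally show ?thesis .
    qed
    ultimately have "\<bar>y\<bar> \<le> 4 * int n" "\<bar>x\<bar> \<le> 4 * q * int n"
      using norm_form_eq_square_plus[of x y] by metis+
    then show "z \<in> (\<lambda>(x, y). of_int x + of_int y * \<omega>) ` ?B"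
      using xy by (intro image_eqI[of _ _ "(x, y)"]) auto
  qed
qed auto

section \<open>Divisibility in the order\<close>

lemma order_dvd_mult_right: "a dvd\<^sub>o b \<Longrightarrow> c \<in> quad_order \<Longrightarrow> a dvd\<^sub>o b * c"
  unfolding order_dvd_def by (metis mult.assoc mult_in_quad_order)

lemma order_dvd_mult_left: "a dvd\<^sub>o b \<Longrightarrow> c \<in> quad_order \<Longrightarrow> a dvd\<^sub>o c * b"
  using order_dvd_mult_right by (simp add: mult.commute)

lemma order_dvd_triv_left [simp]: "c \<in> quad_order \<Longrightarrow> a dvd\<^sub>o a * c"
  unfolding order_dvd_def by blast

lemma order_dvd_add: "a dvd\<^sub>o b \<Longrightarrow> a dvd\<^sub>o c \<Longrightarrow> a dvd\<^sub>o b + c"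
  unfolding order_dvd_def by (metis add_in_quad_order distrib_left)

lemma order_dvd_diff: "a dvd\<^sub>o b \<Longrightarrow> a dvd\<^sub>o c \<Longrightarrow> a dvd\<^sub>o b - c"
  unfolding order_dvd_def by (metis diff_in_quad_order right_diff_distrib)

lemma cnj_order_dvd: "a dvd\<^sub>o b \<Longrightarrow> cnj a dvd\<^sub>o cnj b"
  unfolding order_dvd_def by (metis cnj_in_quad_order complex_cnj_mult)

lemma norm_shell_mult:
  "z \<in> norm_shell a \<Longrightarrow> w \<in> norm_shell b \<Longrightarrow> z * w \<in> norm_shell (a * b)"
  by (auto simp: norm_shell_def norm_mult power_mult_distrib)

lemma norm_shell_cancel:
  assumes "z * w \<in> norm_shell (a * b)" "z \<in> norm_shell a" "w \<in> quad_order" "a > 0"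
  shows "w \<in> norm_shell b"
  using assms by (auto simp: norm_shell_def norm_mult power_mult_distrib)

lemma norm_shell_cnj: "z \<in> norm_shell n \<Longrightarrow> cnj z \<in> norm_shell n"
  by (auto simp: norm_shell_def)

lemma norm_shell_mult_cnj: "z \<in> norm_shell n \<Longrightarrow> z * cnj z = of_nat n"
  by (simp add: norm_shell_def flip: complex_norm_square of_real_power)

lemma of_nat_in_norm_shell: "of_nat n \<in> norm_shell (n^2)"
  by (simp add: norm_shell_def)

lemma order_in_norm_shell: "z \<in> quad_order \<Longrightarrow> \<exists>n. z \<in> norm_shell n"
  unfolding norm_shell_def by (blast elim: cmod_order_nat)

lemma norm_shell_unique: "z \<in> norm_shell m \<Longrightarrow> z \<in> norm_shell n \<Longrightarrow> m = n"
  by (simp add: norm_shell_def)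

lemma order_dvd_imp_norm_dvd:
  assumes "z dvd\<^sub>o w" "z \<in> norm_shell a" "w \<in> norm_shell b"
  shows "a dvd b"
proof -
  from assms obtain c where c: "c \<in> quad_order" "w = z * c" by (auto simp: order_dvd_def)
  then obtain n where "c \<in> norm_shell n" using order_in_norm_shell by blast
  then have "w \<in> norm_shell (a * n)" using c assms norm_shell_mult by simp
  then show ?thesis using assms norm_shell_unique by fastforce
qed

section \<open>Elements of prime norm are prime\<close>

text \<open>The residue ring modulo \<pi> is the field with p elements: the coefficient y of
  \<omega> in \<pi> is prime to p, so \<omega> can be solved for modulo \<pi>.\<close>

lemma exists_residue:
  assumes \<pi>: "\<pi> \<in> norm_shell p" and p: "prime p" and z: "z \<in> quad_order"
  shows "\<exists>n::int. \<pi> dvd\<^sub>o z - of_int n"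
proof -
  obtain x y where xy: "\<pi> = of_int x + of_int y * \<omega>"
    using \<pi> by (auto simp: norm_shell_def elim: quad_orderE)
  then have "real_of_int (norm_form t q x y) = real_of_int (int p)"
    using \<pi> cmod_order[of x y] by (simp add: norm_shell_def)
  then have N: "x^2 + t * x * y + q * y^2 = int p"
    unfolding of_int_eq_iff by (simp add: norm_form_def)
  have pi: "prime (int p)" using p by simp
  \<comment> \<open>If p divided y, it would divide x too, and then p^2 would divide the norm
    p.\<close>
  have "\<not> int p dvd y"
  proof
    assume y: "int p dvd y"
    have "x^2 = int p - y * (t * x + q * y)"
      using N by (simp add: algebra_simps power2_eq_square)
    then have "int p dvd x^2" using y by (simp add: dvd_mult2)
    then have "int p dvd x" using pi prime_dvd_power by blast
    then obtain u v where "x = int p * u" "y = int p * v" using y by (auto simp: dvd_def)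
    then have "int p * (int p * norm_form t q u v) = int p * 1"
      using N by (simp add: norm_form_def power2_eq_square algebra_simps)
    then have "int p * norm_form t q u v = 1" using p by (simp add: prime_gt_0_nat)
    then have "int p dvd 1" by (metis dvd_triv_left)
    then show False using pi not_prime_unit by blast
  qed
  then have "coprime y (int p)"
    using pi by (metis coprime_commute prime_imp_coprime)
  then obtain y' where "[y * y' = 1] (mod int p)" using cong_solve_coprime_int by blast
  then obtain k where k: "1 = y * y' + int p * k"
    by (metis cong_iff_lin)
  \<comment> \<open>Multiplying \<pi> = x + y \<omega> by the inverse y' of y modulo p gives y' x +
    \<omega> up to a multiple of p, and p is the multiple \<open>\<pi> * cnj \<pi>\<close> of
    \<pi>.\<close>
  have "\<omega> - of_int (- (y' * x)) = of_int 1 * \<omega> + of_int (y' * x)" by simp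
  also have "\<dots> = \<pi> * of_int y' + of_nat p * (of_int k * \<omega>)"
    unfolding k by (simp add: xy algebra_simps)
  also have "\<dots> = \<pi> * (of_int y' + cnj \<pi> * (of_int k * \<omega>))"
    by (simp add: norm_shell_mult_cnj[OF \<pi>, symmetric] algebra_simps)
  also have "\<pi> dvd\<^sub>o \<dots>"
    using \<pi> by (intro order_dvd_triv_left add_in_quad_order mult_in_quad_order cnj_in_quad_order) (auto simp: norm_shell_def)
  finally have w: "\<pi> dvd\<^sub>o \<omega> - of_int (- (y' * x))" .
  obtain u v where "z = of_int u + of_int v * \<omega>" using z by (rule quad_orderE)
  then have "z - of_int (u - v * y' * x) = of_int v * (\<omega> - of_int (- (y' * x)))"
    by (simp add: algebra_simps)
  then show ?thesis using order_dvd_mult_left[OF w, of "of_int v"] by (metis of_int_in_quad_order)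
qed

text \<open>Modulo \<pi> both factors are rational integers m and n. Taking norms turns the
  divisibility of m n by \<pi> into p dividing (m n)^2, so p divides m or n, and \<pi> divides
  p.\<close>

lemma order_prime_dvd_mult:
  assumes \<pi>: "\<pi> \<in> norm_shell p" and p: "prime p" and z: "z \<in> quad_order" and w: "w \<in> quad_order"
    and dvd: "\<pi> dvd\<^sub>o z * w"
  shows "\<pi> dvd\<^sub>o z \<or> \<pi> dvd\<^sub>o w"
proof -
  obtain m n :: int where m: "\<pi> dvd\<^sub>o z - of_int m" and n: "\<pi> dvd\<^sub>o w - of_int n"
    using exists_residue[OF \<pi> p] z w by blast
  have "of_int (m * n) = z * w - (z - of_int m) * w - of_int m * (w - of_int n)"
    by (simp add: algebra_simps)
  moreover have "\<pi> dvd\<^sub>o \<dots>"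
    by (intro order_dvd_diff dvd order_dvd_mult_right[OF m] order_dvd_mult_left[OF n] w of_int_in_quad_order)
  ultimately have mn: "\<pi> dvd\<^sub>o of_int (m * n)" by simp
  have "of_int (m * n) \<in> norm_shell (nat ((m * n)^2))"
    by (simp add: norm_shell_def flip: of_int_mult)
  from order_dvd_imp_norm_dvd[OF mn \<pi> this] have "int p dvd (m * n)^2"
    by (metis int_dvd_int_iff int_nat_eq zero_le_power2)
  then have "int p dvd m \<or> int p dvd n"
    using p by (metis prime_dvd_mult_iff prime_dvd_power prime_nat_int_transfer)
  moreover have *: "\<pi> dvd\<^sub>o of_int k" if "int p dvd k" for k
  proof -
    from that obtain l where "k = int p * l" by auto
    then have "of_int k = \<pi> * (cnj \<pi> * of_int l)"
      using norm_shell_mult_cnj[OF \<pi>] by (simp add: mult.assoc[symmetric])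
    then show ?thesis
      using \<pi> by (auto simp: norm_shell_def intro!: order_dvd_triv_left)
  qed
  ultimately show ?thesis
    using order_dvd_add[OF m *, of m] order_dvd_add[OF n *, of n] by auto
qed

lemma order_prime_dvd_power:
  assumes "\<pi> \<in> norm_shell p" "prime p" "z \<in> quad_order" "\<pi> dvd\<^sub>o z ^ n"
  shows "\<pi> dvd\<^sub>o z"
  using assms(4)
proof (induction n)
  case 0
  have "1 \<in> norm_shell 1" using of_nat_in_norm_shell[of 1] by simp
  then have "p dvd 1" using 0 order_dvd_imp_norm_dvd[OF _ assms(1), of 1 1] by simp
  then show ?case using assms(2) by (simp add: not_prime_unit)
next
  case (Suc n)
  have "z ^ n \<in> quad_order" for n
    by (induction n) (use assms(3) of_int_in_quad_order[of 1] in auto)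
  then show ?case
    using order_prime_dvd_mult[OF assms(1-3), of "z ^ n"] Suc by auto
qed

section \<open>Shells of norm divisible by the norm of a prime element\<close>

text \<open>The prime \<pi> divides p n = \<open>z * cnj z\<close>, hence z or its conjugate; in the
  second case the divisibility is conjugated.\<close>

lemma norm_shell_prime_dvd:
  assumes "\<pi> \<in> norm_shell p" "prime p" "z \<in> norm_shell (p * n)"
  shows "\<pi> dvd\<^sub>o z \<or> cnj \<pi> dvd\<^sub>o z"
proof -
  have o: "\<pi> \<in> quad_order" "z \<in> quad_order" using assms by (auto simp: norm_shell_def)
  have "z * cnj z = \<pi> * (cnj \<pi> * of_nat n)"
    using norm_shell_mult_cnj[OF assms(1)] norm_shell_mult_cnj[OF assms(3)] by (simp add: mult.assoc[symmetric])
  then have "\<pi> dvd\<^sub>o z * cnj z" using o by (auto intro!: order_dvd_triv_left)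
  then have "\<pi> dvd\<^sub>o z \<or> \<pi> dvd\<^sub>o cnj z"
    using order_prime_dvd_mult[OF assms(1,2)] o by blast
  then show ?thesis using cnj_order_dvd by fastforce
qed

lemma norm_shell_divide:
  assumes "\<pi> dvd\<^sub>o z" "\<pi> \<in> norm_shell a" "z \<in> norm_shell (a * n)" "a > 0"
  shows "z \<in> (*) \<pi> ` norm_shell n"
  using assms norm_shell_cancel unfolding order_dvd_def by blast

lemma norm_shell_ramified:
  assumes "\<pi> \<in> norm_shell p" "prime p" "\<pi> dvd\<^sub>o cnj \<pi>"
  shows "norm_shell (p * n) = (*) \<pi> ` norm_shell n"
proof
  show "norm_shell (p * n) \<subseteq> (*) \<pi> ` norm_shell n"
  proof
    fix z assume z: "z \<in> norm_shell (p * n)"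
    have "\<pi> dvd\<^sub>o z"
      using norm_shell_prime_dvd[OF assms(1,2) z] assms(3) unfolding order_dvd_def
      by (metis mult.assoc mult_in_quad_order)
    then show "z \<in> (*) \<pi> ` norm_shell n"
      using norm_shell_divide[OF _ assms(1) z] assms(2) prime_gt_0_nat by blast
  qed
qed (use assms norm_shell_mult in auto)

lemma norm_shell_split:
  assumes "\<pi> \<in> norm_shell p" "prime p"
  shows "norm_shell (p * n) = (*) \<pi> ` norm_shell n \<union> (*) (cnj \<pi>) ` norm_shell n"
proof
  show "norm_shell (p * n) \<subseteq> (*) \<pi> ` norm_shell n \<union> (*) (cnj \<pi>) ` norm_shell n"
    using norm_shell_prime_dvd[OF assms] norm_shell_divide[OF _ assms(1)]
      norm_shell_divide[OF _ norm_shell_cnj[OF assms(1)]] prime_gt_0_nat[OF assms(2)] by blast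
qed (use norm_shell_mult[OF assms(1)] norm_shell_mult[OF norm_shell_cnj[OF assms(1)]] in auto)

text \<open>Since \<pi> does not divide its conjugate, it divides the cofactor of
  \<open>cnj \<pi>\<close> in z, and the two factors multiply to p. This controls the overlap in
  \<open>norm_shell_split\<close>.\<close>

lemma norm_shell_split_Int:
  assumes "\<pi> \<in> norm_shell p" "prime p" "\<not> \<pi> dvd\<^sub>o cnj \<pi>"
    and "z \<in> (*) \<pi> ` norm_shell n \<inter> (*) (cnj \<pi>) ` norm_shell n"
  shows "\<exists>v. z = of_nat p * v \<and> v \<in> quad_order"
proof -
  from assms(4) obtain u w where uw: "z = \<pi> * u" "z = cnj \<pi> * w" "u \<in> quad_order" "w \<in> quad_order"
    unfolding norm_shell_def by blast
  have o: "cnj \<pi> \<in> quad_order" using assms by (auto simp: norm_shell_def)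
  have "\<pi> dvd\<^sub>o cnj \<pi> * w" using uw unfolding order_dvd_def by metis
  then have "\<pi> dvd\<^sub>o w" using order_prime_dvd_mult[OF assms(1,2) o uw(4)] assms(3) by blast
  then obtain v where "v \<in> quad_order" "w = \<pi> * v" by (auto simp: order_dvd_def)
  then show ?thesis
    using uw(2) norm_shell_mult_cnj[OF assms(1)] by (intro exI[of _ v]) (simp add: ac_simps)
qed

lemma norm_shell_pos_ne_0: "z \<in> norm_shell n \<Longrightarrow> n > 0 \<Longrightarrow> z \<noteq> 0"
  by (auto simp: norm_shell_def)

section \<open>The Hecke recursion for sums of squares\<close>

lemma sum_squares_image_mult:
  assumes "z \<noteq> 0"
  shows "(\<Sum>w\<in>(*) z ` norm_shell n. w^2) = z^2 * square_sum n"
  using assms by (subst sum.reindex) (auto simp: inj_on_def square_sum_def sum_distrib_left power_mult_distrib)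

text \<open>Inclusion-exclusion for the two images in \<open>norm_shell_split\<close>; the next two
  lemmas evaluate the overlap.\<close>

lemma square_sum_split:
  assumes "\<pi> \<in> norm_shell p" "prime p"
  shows "square_sum (p * n) = (\<pi>^2 + cnj \<pi>^2) * square_sum n
    - (\<Sum>w\<in>(*) \<pi> ` norm_shell n \<inter> (*) (cnj \<pi>) ` norm_shell n. w^2)"
proof -
  have "\<pi> \<noteq> 0" using norm_shell_pos_ne_0[OF assms(1)] prime_gt_0_nat[OF assms(2)] by blast
  then show ?thesis
    unfolding square_sum_def[of "p * n"] norm_shell_split[OF assms]
    by (subst sum_Un) (simp_all add: sum_squares_image_mult distrib_right)
qed

lemma square_sum_split_coprime:
  assumes "\<pi> \<in> norm_shell p" "prime p" "\<not> \<pi> dvd\<^sub>o cnj \<pi>" "\<not> p dvd n"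
  shows "square_sum (p * n) = (\<pi>^2 + cnj \<pi>^2) * square_sum n"
proof -
  \<comment> \<open>A common element is a multiple of p, so its norm p n would be divisible by
    p^2.\<close>
  have "(*) \<pi> ` norm_shell n \<inter> (*) (cnj \<pi>) ` norm_shell n = {}"
  proof (rule ccontr)
    assume "(*) \<pi> ` norm_shell n \<inter> (*) (cnj \<pi>) ` norm_shell n \<noteq> {}"
    then obtain z where z: "z \<in> (*) \<pi> ` norm_shell n \<inter> (*) (cnj \<pi>) ` norm_shell n" by blast
    then obtain v where v: "z = of_nat p * v" "v \<in> quad_order"
      using norm_shell_split_Int[OF assms(1-3)] by blast
    have "z \<in> norm_shell (p * n)" using z norm_shell_split[OF assms(1,2)] by blast
    then have "p^2 dvd p * n"
      using order_dvd_imp_norm_dvd[OF _ of_nat_in_norm_shell, of p z] v by simp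
    then show False using assms(2,4) prime_gt_0_nat by (fastforce simp: power2_eq_square)
  qed
  then show ?thesis using square_sum_split[OF assms(1,2), of n] by simp
qed

text \<open>Here the overlap consists exactly of p times the elements of norm n, and p^2 is the
  product of the squares of \<pi> and its conjugate.\<close>

lemma square_sum_split_Suc:
  assumes "\<pi> \<in> norm_shell p" "prime p" "\<not> \<pi> dvd\<^sub>o cnj \<pi>"
  shows "square_sum (p * (p * n)) = (\<pi>^2 + cnj \<pi>^2) * square_sum (p * n)
    - \<pi>^2 * cnj \<pi>^2 * square_sum n"
proof -
  have p0: "p > 0" using assms prime_gt_0_nat by blast
  have "(*) \<pi> ` norm_shell (p * n) \<inter> (*) (cnj \<pi>) ` norm_shell (p * n) = (*) (of_nat p) ` norm_shell n"
    (is "?I = _")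
  proof
    show "?I \<subseteq> (*) (of_nat p) ` norm_shell n"
    proof
      fix z assume z: "z \<in> ?I"
      then obtain v where v: "z = of_nat p * v" "v \<in> quad_order"
        using norm_shell_split_Int[OF assms] by blast
      have "z \<in> norm_shell (p * (p * n))" using z norm_shell_split[OF assms(1,2)] by blast
      then have "of_nat p * v \<in> norm_shell (p^2 * n)"
        using v by (simp add: power2_eq_square mult.assoc)
      then have "v \<in> norm_shell n"
        using norm_shell_cancel[OF _ of_nat_in_norm_shell] v p0 by simp
      then show "z \<in> (*) (of_nat p) ` norm_shell n" using v by blast
    qed
    show "(*) (of_nat p) ` norm_shell n \<subseteq> ?I"
    proof
      fix z assume "z \<in> (*) (of_nat p) ` norm_shell n"
      then obtain v where v: "v \<in> norm_shell n" "z = of_nat p * v" by blast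
      then have "z = \<pi> * (cnj \<pi> * v)" "z = cnj \<pi> * (\<pi> * v)"
        using norm_shell_mult_cnj[OF assms(1)] by (simp_all add: ac_simps)
      then show "z \<in> ?I"
        using norm_shell_mult[OF assms(1) v(1)] norm_shell_mult[OF norm_shell_cnj[OF assms(1)] v(1)] by blast
    qed
  qed
  moreover have "(of_nat p)^2 = \<pi>^2 * cnj \<pi>^2"
    using norm_shell_mult_cnj[OF assms(1)] by (metis power_mult_distrib)
  ultimately show ?thesis
    using square_sum_split[OF assms(1,2), of "p * n"] sum_squares_image_mult[of "of_nat p" n] p0 by simp
qed

text \<open>The closed form of the recursion, kept free of division. The recursion has order two, so
  the induction is strong, with k = 0 and k = 1 as starting values.\<close>

lemma square_sum_split_power:
  assumes "\<pi> \<in> norm_shell p" "prime p" "\<not> \<pi> dvd\<^sub>o cnj \<pi>" "\<not> p dvd n"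
  shows "(\<pi>^2 - cnj \<pi>^2) * square_sum (p ^ k * n)
    = ((\<pi>^2) ^ Suc k - (cnj \<pi>^2) ^ Suc k) * square_sum n"
proof (induction k rule: less_induct)
  case (less k)
  consider "k = 0" | "k = 1" | l where "k = Suc (Suc l)"
    by (metis One_nat_def not0_implies_Suc)
  then show ?case
  proof cases
    case 2
    then show ?thesis
      using square_sum_split_coprime[OF assms] by (simp add: algebra_simps power2_eq_square)
  next
    case 3
    have rec: "square_sum (p ^ k * n) = (\<pi>^2 + cnj \<pi>^2) * square_sum (p ^ Suc l * n)
      - \<pi>^2 * cnj \<pi>^2 * square_sum (p ^ l * n)"
      using square_sum_split_Suc[OF assms(1-3), of "p ^ l * n"] 3 by (simp add: mult.assoc)
    have "(\<pi>^2 - cnj \<pi>^2) * square_sum (p ^ k * n)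
      = (\<pi>^2 + cnj \<pi>^2) * ((\<pi>^2 - cnj \<pi>^2) * square_sum (p ^ Suc l * n))
      - \<pi>^2 * cnj \<pi>^2 * ((\<pi>^2 - cnj \<pi>^2) * square_sum (p ^ l * n))"
      unfolding rec by (simp only: algebra_simps)
    also have "\<dots> = (\<pi>^2 + cnj \<pi>^2) * (((\<pi>^2) ^ Suc (Suc l) - (cnj \<pi>^2) ^ Suc (Suc l)) * square_sum n)
      - \<pi>^2 * cnj \<pi>^2 * (((\<pi>^2) ^ Suc l - (cnj \<pi>^2) ^ Suc l) * square_sum n)"
      using less[of l] less[of "Suc l"] 3 by simp
    also have "\<dots> = ((\<pi>^2) ^ Suc k - (cnj \<pi>^2) ^ Suc k) * square_sum n"
      unfolding 3 power_Suc by (simp only: algebra_simps)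
    finally show ?thesis .
  qed simp
qed

text \<open>Equality would make \<pi> divide a power of its conjugate, hence the conjugate
  itself.\<close>

lemma split_powers_ne:
  assumes "\<pi> \<in> norm_shell p" "prime p" "\<not> \<pi> dvd\<^sub>o cnj \<pi>"
  shows "(\<pi>^2) ^ Suc k \<noteq> (cnj \<pi>^2) ^ Suc k"
proof
  assume "(\<pi>^2) ^ Suc k = (cnj \<pi>^2) ^ Suc k"
  then have "cnj \<pi> ^ (2 * Suc k) = \<pi> ^ (2 * Suc k)"
    by (simp only: power_mult)
  then have "cnj \<pi> ^ (2 * Suc k) = \<pi> * \<pi> ^ (2 * k + 1)"
    by simp
  moreover have o: "\<pi> \<in> quad_order" using assms by (simp add: norm_shell_def)
  moreover have "\<pi> ^ n \<in> quad_order" for n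
    by (induction n) (use o of_int_in_quad_order[of 1] in auto)
  ultimately have "\<pi> dvd\<^sub>o cnj \<pi> ^ (2 * Suc k)" unfolding order_dvd_def by blast
  then show False using order_prime_dvd_power[OF assms(1,2)] o assms(3) by blast
qed

end

section \<open>Class number one\<close>

text \<open>Class number one in the language of forms: every Gauss-reduced form of this discriminant
  has leading coefficient 1. The bound \<open>disc_less\<close> puts the discriminant below -4,
  which excludes the Gaussian and Eisenstein integers and leaves only the units 1 and -1.\<close>

locale class_number_one_order = imaginary_quadratic_order +
  assumes reduced_form: "\<And>a b c. b^2 - 4 * a * c = t^2 - 4 * q \<Longrightarrow> \<bar>b\<bar> \<le> a \<Longrightarrow> a \<le> c \<Longrightarrow> a = 1"
    and disc_less: "t^2 + 4 < 4 * q"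
begin

text \<open>Gauss reduction: translate x to make the middle coefficient small, then swap the outer
  coefficients if the last is smaller than a. The swap lowers a, and a form that needs no swap is
  reduced, so it has a = 1.\<close>

lemma form_represents_one:
  assumes "b^2 - 4 * a * c = t^2 - 4 * q" "a > 0"
  shows "\<exists>x y :: int. a * x^2 + b * x * y + c * y^2 = 1"
  using assms
proof (induction "nat a" arbitrary: a b c rule: less_induct)
  case less
  \<comment> \<open>This translation moves b to its representative modulo 2 a in the interval from
    -a to a - 1.\<close>
  define k where "k = - ((b + a) div (2 * a))"
  define b' where "b' = b + 2 * a * k"
  define c' where "c' = a * k^2 + b * k + c"
  have "b' = (b + a) mod (2 * a) - a"
    unfolding b'_def k_def using minus_mult_div_eq_mod[of "b + a" "2 * a"] by (simp add: algebra_simps)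
  moreover have "0 \<le> (b + a) mod (2 * a)" "(b + a) mod (2 * a) < 2 * a"
    using less.prems(2) by simp_all
  ultimately have b': "\<bar>b'\<bar> \<le> a" by linarith
  have disc: "b'^2 - 4 * a * c' = t^2 - 4 * q"
    unfolding less.prems(1)[symmetric] b'_def c'_def by (simp add: power2_eq_square algebra_simps)
  have form: "a * (x + k * y)^2 + b * (x + k * y) * y + c * y^2 = a * x^2 + b' * x * y + c' * y^2" for x y
    unfolding b'_def c'_def by (simp add: power2_eq_square algebra_simps)
  show ?case
  proof (cases "a \<le> c'")
    case True
    then have "a = 1" using reduced_form[OF disc b'] by simp
    then have "a * 1^2 + b * 1 * 0 + c * 0^2 = 1" by simp
    then show ?thesis by blast
  next
    case False
    \<comment> \<open>The negative discriminant gives c' the sign of a, so the swapped form also has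
      a positive leading coefficient.\<close>
    have "4 * (a * c') = b'^2 + (4 * q - t^2)" using disc by simp
    also have "\<dots> > 0" using disc_neg zero_le_power2[of b'] by linarith
    finally have "a * c' > 0" by simp
    then have c': "c' > 0" using less.prems(2) zero_less_mult_pos by blast
    have "b'^2 - 4 * c' * a = t^2 - 4 * q" using disc by (simp add: mult.commute mult.left_commute)
    then obtain x y where "c' * x^2 + b' * x * y + a * y^2 = 1"
      using less.hyps[of c' b' a] c' False less.prems(2) by auto
    then have "a * (y + k * x)^2 + b * (y + k * x) * x + c * x^2 = 1"
      unfolding form by (simp add: ac_simps)
    then show ?thesis by blast
  qed
qed

text \<open>If \<open>p\<close> divides the norm of \<open>s + \<omega>\<close>, then the norm on the ideal \<open>(p, s + \<omega>)\<close> is \<open>p\<close> times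
  a form of the same discriminant.\<close>

lemma norm_shell_nonempty_if_root:
  assumes "p > 0" "int p dvd norm_form t q s 1"
  shows "norm_shell p \<noteq> {}"
proof -
  obtain c where c: "norm_form t q s 1 = int p * c" using assms by auto
  have "(2 * s + t)^2 - 4 * int p * c = t^2 - 4 * q"
    using c by (simp add: norm_form_def power2_eq_square algebra_simps)
  then obtain x y where xy: "int p * x^2 + (2 * s + t) * x * y + c * y^2 = 1"
    using form_represents_one assms(1) by fastforce
  have "norm_form t q (int p * x + s * y) y = int p * (int p * x^2 + (2 * s + t) * x * y) + norm_form t q s 1 * y^2"
    by (simp add: norm_form_def power2_eq_square algebra_simps)
  also have "\<dots> = int p * (int p * x^2 + (2 * s + t) * x * y + c * y^2)"
    unfolding c by (simp add: algebra_simps)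
  finally have "norm_form t q (int p * x + s * y) y = int p" by (simp add: xy)
  then have "of_int (int p * x + s * y) + of_int y * \<omega> \<in> norm_shell p"
    using cmod_order[of "int p * x + s * y" y] unfolding norm_shell_def quad_order_def
    by (intro CollectI conjI) (blast, simp only: of_int_of_nat_eq)
  then show ?thesis by blast
qed

text \<open>If p did not divide y, scaling y to 1 modulo p would produce an s with p dividing the
  norm of s + \<omega>, and hence an element of norm p. So p divides y, and then also x.\<close>

lemma inert_prime_dvd:
  assumes p: "prime p" "norm_shell p = {}" and z: "z \<in> norm_shell n" and dvd: "p dvd n"
  shows "of_nat p dvd\<^sub>o z"
proof -
  have pi: "prime (int p)" using p by simp
  obtain x y where xy: "z = of_int x + of_int y * \<omega>"
    using z by (auto simp: norm_shell_def elim: quad_orderE)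
  then have "real_of_int (norm_form t q x y) = real_of_int (int n)"
    using z cmod_order[of x y] by (simp add: norm_shell_def)
  then have N: "norm_form t q x y = int n" unfolding of_int_eq_iff .
  have y: "int p dvd y"
  proof (rule ccontr)
    assume "\<not> int p dvd y"
    then have "coprime y (int p)"
      using pi by (metis coprime_commute prime_imp_coprime)
    then obtain y' where y': "[y * y' = 1] (mod int p)" using cong_solve_coprime_int by blast
    have "[norm_form t q (x * y') (y * y') = norm_form t q (x * y') 1] (mod int p)"
      unfolding norm_form_def by (intro cong_add cong_mult cong_pow cong_refl y')
    moreover have "norm_form t q (x * y') (y * y') = y'^2 * int n"
      unfolding N[symmetric] by (simp add: norm_form_def power2_eq_square algebra_simps)
    ultimately have "int p dvd norm_form t q (x * y') 1"
      using dvd cong_dvd_iff by fastforce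
    then show False using norm_shell_nonempty_if_root p prime_gt_0_nat by blast
  qed
  have "x^2 = int n - y * (t * x + q * y)"
    using N by (simp add: norm_form_def algebra_simps power2_eq_square)
  then have "int p dvd x^2" using y dvd by (simp add: dvd_mult2)
  then have "int p dvd x" using pi prime_dvd_power by blast
  then obtain u v where "x = int p * u" "y = int p * v" using y by (auto simp: dvd_def)
  then have "z = of_nat p * (of_int u + of_int v * \<omega>)" using xy by (simp add: algebra_simps)
  then show ?thesis by (auto intro!: order_dvd_triv_left)
qed

text \<open>A unit satisfies 4 = (2 x + t y)^2 + (4 q - t^2) y^2 with 4 q - t^2 > 4, which forces y
  = 0.\<close>

lemma norm_shell_1: "norm_shell 1 = {1, - 1}"
proof
  show "norm_shell 1 \<subseteq> {1, - 1}"
  proof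
    fix z assume z: "z \<in> norm_shell 1"
    then obtain x y where xy: "z = of_int x + of_int y * \<omega>"
      by (auto simp: norm_shell_def elim: quad_orderE)
    then have "real_of_int (norm_form t q x y) = real_of_int 1"
      using z cmod_order[of x y] by (simp add: norm_shell_def)
    then have N: "norm_form t q x y = 1" unfolding of_int_eq_iff .
    have "y = 0"
    proof (rule ccontr)
      assume "y \<noteq> 0"
      then have "y^2 > 0" by simp
      then have "1 \<le> y^2" by linarith
      then have "4 * 1 < (4 * q - t^2) * y^2"
        using disc_less by (intro mult_less_le_imp_less) auto
      also have "\<dots> = 4 - (2 * x + t * y)^2"
        using norm_form_eq_square_plus(1)[of x y] N by simp
      also have "\<dots> \<le> 4" by simp
      finally show False by simp
    qed
    then have "x^2 = 1" using N by (simp add: norm_form_def)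
    then show "z \<in> {1, - 1}" using xy \<open>y = 0\<close> by (auto simp: power2_eq_1_iff)
  qed
  have "1 \<in> norm_shell 1" using of_nat_in_norm_shell[of 1] by simp
  then show "{1, - 1} \<subseteq> norm_shell 1" by (auto simp: norm_shell_def)
qed

section \<open>Nonvanishing of the sums of squares\<close>

theorem square_sum_ne_0:
  assumes "n > 0" "norm_shell n \<noteq> {}"
  shows "square_sum n \<noteq> 0"
  using assms
proof (induction n rule: less_induct)
  case (less n)
  show ?case
  proof (cases "n = 1")
    case True
    then show ?thesis by (simp add: square_sum_def norm_shell_1 del: One_nat_def)
  next
    case False
    then obtain p where p: "prime p" "p dvd n" using prime_factor_nat by blast
    have p1: "p > 1" using p prime_gt_1_nat by blast
    consider "norm_shell p = {}"
      | \<pi> where "\<pi> \<in> norm_shell p" "\<pi> dvd\<^sub>o cnj \<pi>"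
      | \<pi> where "\<pi> \<in> norm_shell p" "\<not> \<pi> dvd\<^sub>o cnj \<pi>"
      by blast
    then show ?thesis
    proof cases
      case 1
      have dvd: "of_nat p dvd\<^sub>o z" if "z \<in> norm_shell n" for z
        using inert_prime_dvd[OF p(1) 1 that p(2)] .
      \<comment> \<open>Some element of norm n exists and is a multiple of p; its norm is then a
        multiple of p^2.\<close>
      have "p^2 dvd n"
        using less.prems(2) dvd order_dvd_imp_norm_dvd[OF _ of_nat_in_norm_shell] by blast
      then obtain m where m: "n = p^2 * m" by auto
      have "norm_shell n = (*) (of_nat p) ` norm_shell m"
        using dvd norm_shell_divide[OF _ of_nat_in_norm_shell] norm_shell_mult[OF of_nat_in_norm_shell] p1
        unfolding m by fastforce
      moreover have "m < n" "m > 0" using m less.prems(1) p1 one_less_power[of p 2] by simp_all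
      ultimately show ?thesis
        using less.IH[of m] less.prems(2) sum_squares_image_mult[of "of_nat p" m] p1
        by (simp add: square_sum_def[of n])
    next
      case 2
      obtain m where m: "n = p * m" using p by auto
      have "norm_shell n = (*) \<pi> ` norm_shell m"
        using norm_shell_ramified[OF 2(1) p(1) 2(2)] m by simp
      moreover have "m < n" "m > 0" using m less.prems(1) p1 by simp_all
      moreover have "\<pi> \<noteq> 0" using norm_shell_pos_ne_0[OF 2(1)] p1 by simp
      ultimately show ?thesis
        using less.IH[of m] less.prems(2) sum_squares_image_mult[of \<pi> m]
        by (simp add: square_sum_def[of n])
    next
      case 3
      obtain k m where m: "n = p ^ k * m" "\<not> p dvd m"
        using less.prems(1) p1 multiplicity_decompose'[of n p] by (metis not_is_unit_0 not_less0 nat_dvd_1_iff_1 less_irrefl)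
      have "k \<noteq> 0" using m p by (metis mult_1 power_0)
      then have "m < n" "m > 0"
        using m less.prems(1) p1 one_less_power[of p k] by simp_all
      \<comment> \<open>Stripping off one factor \<pi> or \<open>cnj \<pi>\<close> at a time carries
        nonemptiness down to m, so that the induction hypothesis applies there.\<close>
      have "norm_shell (p ^ j * m) \<noteq> {} \<Longrightarrow> norm_shell m \<noteq> {}" for j
        by (induction j) (use norm_shell_split[OF 3(1) p(1)] in \<open>auto simp: mult.assoc\<close>)
      then have "square_sum m \<noteq> 0"
        using less.IH[OF \<open>m < n\<close> \<open>m > 0\<close>] less.prems(2) m by blast
      then show ?thesis
        using square_sum_split_power[OF 3(1) p(1) 3(2) m(2), of k] split_powers_ne[OF 3(1) p(1) 3(2), of k] m(1)
        by auto
    qed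
  qed
qed

end

text \<open>A reduced form satisfies 3 a^2 \<le> 4 q - t^2 \<le> 163, so a \<le> 7, and finitely
  many triples (a, b, discriminant) remain to be checked.\<close>

lemma class_number_one_orderI:
  fixes t q :: int
  assumes "(t, q) \<in> {(0, 2), (1, 2), (1, 3), (1, 5), (1, 11), (1, 17), (1, 41)}"
  shows "class_number_one_order t q"
proof
  show "t^2 < 4 * q" "t^2 + 4 < 4 * q" using assms by auto
  fix a b c :: int
  assume disc: "b^2 - 4 * a * c = t^2 - 4 * q" and b: "\<bar>b\<bar> \<le> a" and a: "a \<le> c"
  have "a \<noteq> 0" using disc b assms by auto
  then have a0: "a > 0" using b by linarith
  have D: "4 * q - t^2 \<le> 163" using assms by auto
  have "b^2 \<le> a^2" using b abs_le_square_iff[of b a] by simp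
  moreover have "a * a \<le> a * c" using a a0 by simp
  ultimately have "3 * a^2 \<le> 163" using disc D by (simp add: power2_eq_square)
  then have "a^2 < 8^2" by simp
  then have "a < 8" by (rule power_less_imp_less_base) simp
  show "a = 1"
  proof (rule ccontr)
    assume "a \<noteq> 1"
    then have mem: "a \<in> set [2..7]" "b \<in> set [-a..a]" using a0 \<open>a < 8\<close> b by auto
    have tq: "(t, q) \<in> set [(0, 2), (1, 2), (1, 3), (1, 5), (1, 11), (1, 17), (1, 41)]"
      using assms by simp
    \<comment> \<open>The discriminant determines c as the quotient by 4 a. In each case with a
      \<ge> 2 this quotient is either not an integer or smaller than a, against a \<le> c. The
      variable \<open>d\<close> is the pair (t, q).\<close>
    have "\<forall>a\<in>set [2..7]. \<forall>b\<in>set [-a..a].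
        \<forall>d\<in>set [(0, 2), (1, 2), (1, 3), (1, 5), (1, 11), (1, 17), (1, 41 :: int)].
        (b * b + 4 * snd d - fst d * fst d) mod (4 * a) = 0 \<longrightarrow>
        (b * b + 4 * snd d - fst d * fst d) div (4 * a) < a"
      by code_simp
    from this[rule_format, OF mem tq]
    have "(b * b + 4 * q - t * t) mod (4 * a) = 0 \<Longrightarrow> (b * b + 4 * q - t * t) div (4 * a) < a"
      by simp
    moreover have "b * b + 4 * q - t * t = 4 * a * c"
      using disc by (simp add: power2_eq_square)
    ultimately show False using a a0 by simp
  qed
qed

section \<open>The ring of integers\<close>

lemma poly_map_of_int:
  fixes z :: "'a :: comm_ring_1"
  shows "poly (map_poly of_int (p + r)) z = poly (map_poly of_int p) z + poly (map_poly of_int r) z"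
    and "poly (map_poly of_int (p * r)) z = poly (map_poly of_int p) z * poly (map_poly of_int r) z"
    and "poly (map_poly of_int (smult a p)) z = of_int a * poly (map_poly of_int p) z"
proof -
  have "map_poly of_int (p + r) = (map_poly of_int p + map_poly of_int r :: 'a poly)"
    by (intro poly_eqI) (simp add: coeff_map_poly)
  then show "poly (map_poly of_int (p + r)) z = poly (map_poly of_int p) z + poly (map_poly of_int r) z"
    by simp
  have "map_poly of_int (p * r) = (map_poly of_int p * map_poly of_int r :: 'a poly)"
    by (intro poly_eqI) (simp add: coeff_map_poly coeff_mult)
  then show "poly (map_poly of_int (p * r)) z = poly (map_poly of_int p) z * poly (map_poly of_int r) z"
    by simp
  have "map_poly of_int (smult a p) = (smult (of_int a) (map_poly of_int p) :: 'a poly)"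
    by (intro poly_eqI) (simp add: coeff_map_poly)
  then show "poly (map_poly of_int (smult a p)) z = of_int a * poly (map_poly of_int p) z"
    by simp
qed

text \<open>By Gauss's lemma, the primitive quadratic annihilating a nonreal \<open>z\<close> divides the monic integer
  polynomial annihilating \<open>z\<close>, so its leading coefficient is a unit.\<close>

lemma algebraic_int_nonreal_quadratic:
  fixes z :: complex
  assumes z: "algebraic_int z" "Im z \<noteq> 0"
    and f: "degree f = 2" "poly (map_poly of_int f) z = 0"
  shows "\<exists>b c. poly (map_poly of_int [:c, b, 1:]) z = 0"
proof -
  define g where "g = primitive_part f"
  have f0: "f \<noteq> 0" using f by auto
  have "smult (content f) g = f" unfolding g_def by simp
  then have "of_int (content f) * poly (map_poly of_int g) z = 0"
    using f(2) by (metis poly_map_of_int(3))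
  then have gz: "poly (map_poly of_int g) z = 0" using f0 by simp
  have g: "degree g = 2" "content g = 1" "g \<noteq> 0" using f f0 by (auto simp: g_def)
  obtain p :: "int poly" where p: "poly (map_poly of_int p) z = 0" "lead_coeff p = 1"
    using z(1) by (auto simp: algebraic_int_altdef_ipoly)
  \<comment> \<open>Pseudo-division stays within integer polynomials at the price of the factor a.
    The remainder is linear and vanishes at the nonreal z, so it is 0.\<close>
  obtain a s where as: "a \<noteq> 0" "smult a p = g * s + pseudo_mod p g"
    using pseudo_mod(1)[OF g(3), of p] by blast
  define r where "r = pseudo_mod p g"
  have "degree r < 2" using pseudo_mod(2)[OF g(3), of p] g(1) by (auto simp: r_def)
  then obtain r0 r1 where r: "r = [:r0, r1:]"
    by (metis One_nat_def Suc_1 degree_eq_zeroE less_2_cases_iff degree1_coeffs pCons_0_0)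
  have "poly (map_poly of_int (smult a p)) z = poly (map_poly of_int (g * s + r)) z"
    using as r_def by simp
  then have "poly (map_poly of_int r) z = 0"
    using gz p(1) by (simp add: poly_map_of_int)
  then have "of_int r0 + z * of_int r1 = 0" by (simp add: r map_poly_pCons)
  then have "r1 = 0" "r0 = 0" using z(2) by (auto simp: complex_eq_iff)
  then have eq: "smult a p = g * s" using as r r_def by simp
  have "content p dvd lead_coeff p" by (rule content_dvd_coeff)
  then have "content p = 1" using p(2) by (metis content_1 is_unit_content_iff is_unit_normalize normalize_content)
  \<comment> \<open>As p and g are primitive, comparing contents shows that the factor a can be
    cancelled.\<close>
  then have "\<bar>a\<bar> = content s"
    using arg_cong[OF eq, of content] g(2) by (simp add: content_mult)
  then have "a dvd content s" by (metis abs_dvd_iff dvd_refl)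
  then have "[:a:] dvd s" by (simp add: const_poly_dvd_iff_dvd_content)
  then obtain s' where "s = smult a s'" by (auto simp: dvd_def)
  then have "smult a p = smult a (g * s')" using eq by simp
  then have "p = g * s'" using as(1) by (simp only: poly_eq_iff coeff_smult mult_cancel_left simp_thms)
  then have "lead_coeff g dvd 1" using p(2) by (metis dvd_triv_left lead_coeff_mult)
  then have u: "\<bar>lead_coeff g\<bar> = 1" by simp
  obtain c b l where cbl: "g = [:c, b, l:]"
    using g(1) by (metis degree2_coeffs)
  have "l = 1 \<or> l = - 1" using u g(1) by (auto simp: cbl numeral_2_eq_2 split: if_splits)
  then have "poly (map_poly of_int [:l * c, l * b, 1:]) z = 0"
    using gz by (auto simp: cbl map_poly_pCons algebra_simps)
  then show ?thesis by blast
qed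

text \<open>A nonreal z is a root of X^2 - 2 Re(z) X + \<bar>z\<bar>^2. Clearing denominators yields
  an integer quadratic, hence a monic one with root z, whose coefficients must be these. A real z is
  a rational algebraic integer.\<close>

lemma algebraic_int_trace_norm:
  fixes z :: complex
  assumes z: "algebraic_int z" and rat: "2 * Re z \<in> \<rat>" "(cmod z)^2 \<in> \<rat>"
  shows "2 * Re z \<in> \<int>" "(cmod z)^2 \<in> \<int>"
proof -
  have "2 * Re z \<in> \<int> \<and> (cmod z)^2 \<in> \<int>"
  proof (cases "Im z = 0")
    case True
    then have zr: "z = of_real (Re z)" by (simp add: complex_eq_iff)
    then have "algebraic_int (Re z)" using z by (metis algebraic_int_of_real_iff)
    moreover have "Re z \<in> \<rat>" using Rats_divide[OF rat(1), of 2] by simp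
    ultimately have "Re z \<in> \<int>" by (rule rational_algebraic_int_is_int)
    then show ?thesis using True by (simp add: cmod_power2)
  next
    case False
    obtain a1 b1 where 1: "b1 > 0" "2 * Re z = of_int a1 / of_int b1"
      using rat(1) by (auto elim: Rats_cases')
    obtain a2 b2 where 2: "b2 > 0" "(cmod z)^2 = of_int a2 / of_int b2"
      using rat(2) by (auto elim: Rats_cases')
    define f where "f = [:b1 * a2, - a1 * b2, b1 * b2:]"
    have "poly (map_poly of_int f) z
        = of_real (b1 * b2) * (z^2 - of_real (2 * Re z) * z + of_real ((cmod z)^2))"
    proof -
      have "complex_of_real (of_int a1) = of_real (2 * Re z * of_int b1)" using 1 by (simp add: field_simps)
      moreover have "complex_of_real (of_int a2) = of_real ((cmod z)^2 * of_int b2)" using 2 by (simp add: field_simps)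
      ultimately show ?thesis
        by (simp add: f_def map_poly_pCons algebra_simps power2_eq_square)
    qed
    also have "z^2 - of_real (2 * Re z) * z + of_real ((cmod z)^2) = 0"
      unfolding cmod_power2 by (simp add: complex_eq_iff power2_eq_square)
    finally have "poly (map_poly of_int f) z = 0" by simp
    moreover have "degree f = 2" using 1 2 by (simp add: f_def)
    ultimately obtain b c where "poly (map_poly of_int [:c, b, 1:]) z = 0"
      using algebraic_int_nonreal_quadratic[OF z False] by blast
    then have bc: "of_int c + z * (of_int b + z) = 0" by (simp add: map_poly_pCons)
    then have "Im z * (of_int b + 2 * Re z) = 0" by (simp add: complex_eq_iff algebra_simps)
    then have T: "2 * Re z = of_int (- b)" using False by simp
    have "of_int c = - Re (z * (of_int b + z))" using bc by (simp add: complex_eq_iff)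
    also have "of_int b = - (z + cnj z)" using T by (simp add: complex_eq_iff)
    also have "- Re (z * (- (z + cnj z) + z)) = (cmod z)^2"
      unfolding cmod_power2 by (simp add: power2_eq_square)
    finally show ?thesis using T by (metis Ints_of_int)
  qed
  then show "2 * Re z \<in> \<int>" "(cmod z)^2 \<in> \<int>" by auto
qed

text \<open>The square of d \<beta> is an integer, so the rational number d \<beta> is an integer w.
  Then d divides w^2 and, being prime, w.\<close>

lemma rat_square_times_prime_int:
  fixes \<beta> :: real
  assumes "\<beta> \<in> \<rat>" "prime d" "of_nat d * \<beta>^2 \<in> \<int>"
  shows "\<beta> \<in> \<int>"
proof -
  obtain m where m: "real d * \<beta>^2 = of_int m" using assms(3) by (auto simp: Ints_def)
  then have sq: "(real d * \<beta>)^2 = of_int (int d * m)"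
    by (simp add: power2_eq_square algebra_simps)
  have "algebraic_int (sqrt (of_int (int d * m)))"
    by (intro algebraic_int_sqrt int_imp_algebraic_int) simp
  then have "algebraic_int (real d * \<beta>)" unfolding sq[symmetric] by simp
  moreover have "real d * \<beta> \<in> \<rat>" using assms(1) by simp
  ultimately obtain w where w: "real d * \<beta> = of_int w"
    using rational_algebraic_int_is_int by (metis Ints_cases)
  then have "w^2 = int d * m" using sq by (metis of_int_eq_iff of_int_power)
  then have "int d dvd w" using assms(2) prime_dvd_power[of "int d" w 2] by simp
  then obtain l where "w = int d * l" by auto
  then have "\<beta> = of_int l" using w assms(2) prime_gt_0_nat by fastforce
  then show ?thesis by simp
qed

lemma mem_imag_quadratic_field:
  "z \<in> imag_quadratic_field d \<longleftrightarrow> Re z \<in> \<rat> \<and> (\<exists>\<beta>\<in>\<rat>. Im z = \<beta> * sqrt d)"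
proof -
  have s: "csqrt (- of_nat d) = \<i> * of_real (sqrt d)"
    by (subst csqrt_minus) (auto simp flip: of_real_sqrt)
  have rat: "a \<in> \<rat> \<longleftrightarrow> (\<exists>r\<in>\<rat>. a = complex_of_real r)" for a
  proof -
    have "complex_of_rat r = complex_of_real (of_rat r)" for r
      by (cases r) (simp add: of_rat_rat)
    then show ?thesis unfolding Rats_def by auto
  qed
  show ?thesis
  proof
    assume "z \<in> imag_quadratic_field d"
    then show "Re z \<in> \<rat> \<and> (\<exists>\<beta>\<in>\<rat>. Im z = \<beta> * sqrt d)"
      unfolding imag_quadratic_field_def s rat by auto
  next
    assume *: "Re z \<in> \<rat> \<and> (\<exists>\<beta>\<in>\<rat>. Im z = \<beta> * sqrt d)"
    then obtain \<beta> where "\<beta> \<in> \<rat>" "Im z = \<beta> * sqrt d" by blast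
    then have "z = of_real (Re z) + of_real \<beta> * (\<i> * of_real (sqrt d))"
      by (simp add: complex_eq_iff)
    then show "z \<in> imag_quadratic_field d"
      unfolding imag_quadratic_field_def s rat using * \<open>\<beta> \<in> \<rat>\<close> by blast
  qed
qed

lemma int_square_mod_4: "(v::int)^2 mod 4 = (if even v then 0 else 1)"
proof (cases "even v")
  case True
  then obtain k where "v = 2 * k" by blast
  then have "v^2 = 4 * k^2" by (simp add: power2_eq_square)
  then show ?thesis using True by simp
next
  case False
  then obtain k where "v = 2 * k + 1" using oddE by blast
  then have "v^2 = 1 + 4 * (k^2 + k)" by (simp add: power2_eq_square algebra_simps)
  then show ?thesis using False by (simp only: mod_mult_self2) simp
qed

context imaginary_quadratic_order
begin

lemma algebraic_int_quad_order:
  assumes "z \<in> quad_order"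
  shows "algebraic_int z"
proof -
  obtain x y where z: "z = of_int x + of_int y * \<omega>" using assms by (rule quad_orderE)
  define p where "p = [:of_int (norm_form t q x y), - of_int (2 * x + t * y), 1 :: complex:]"
  have cnj: "cnj z = of_int (2 * x + t * y) - z" by (simp add: z cnj_omega algebra_simps)
  have "of_int (norm_form t q x y) = complex_of_real ((cmod z)^2)"
    unfolding z cmod_order by simp
  also have "\<dots> = z * cnj z" by (rule complex_norm_square)
  finally have "of_int (norm_form t q x y) = z * cnj z" .
  then have "poly p z = 0" by (simp add: p_def cnj algebra_simps)
  moreover have "lead_coeff p = 1" "\<forall>i. coeff p i \<in> \<int>"
    by (auto simp: p_def coeff_pCons split: nat.splits)
  ultimately show ?thesis using algebraic_int.intros by blast
qed

text \<open>Write z = (\<tau> + \<eta> sqrt(-d)) / 2. Integrality of trace and norm makes \<tau> and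
  \<eta> integers with \<tau>^2 + d \<eta>^2 divisible by 4, and the residue of d modulo 4 decides
  which parities are possible.\<close>

lemma ring_of_integers_eq:
  assumes d: "prime d"
    and tq: "t = 0 \<and> q = int d \<and> d mod 4 \<noteq> 3 \<or> t = 1 \<and> 4 * q = int d + 1"
  shows "ring_of_integers (imag_quadratic_field d) = quad_order"
proof
  have Re: "Re \<omega> = t / 2" by (simp add: \<omega>_def)
  have Im: "Im \<omega> = (if t = 0 then sqrt d else sqrt d / 2)"
  proof (cases "t = 0")
    case True
    then have "real_of_int (4 * q - t^2) = 2^2 * real d" using tq by simp
    then have "sqrt (real_of_int (4 * q - t^2)) = 2 * sqrt (real d)"
      by (simp only: real_sqrt_mult real_sqrt_abs abs_numeral)
    then show ?thesis using True unfolding \<omega>_def by simp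
  next
    case False
    then have "real_of_int (4 * q - t^2) = real d" using tq by auto
    then show ?thesis using False unfolding \<omega>_def by simp
  qed
  show "quad_order \<subseteq> ring_of_integers (imag_quadratic_field d)"
  proof
    fix z assume z: "z \<in> quad_order"
    then obtain x y where xy: "z = of_int x + of_int y * \<omega>" by (rule quad_orderE)
    have "Re z = of_int x + of_int y * (of_int t / 2)" by (simp add: xy Re)
    then have "Re z \<in> \<rat>" by simp
    moreover have "Im z = (if t = 0 then of_int y else of_int y / 2) * sqrt d" by (simp add: xy Im)
    moreover have "(if t = 0 then of_int y else of_int y / 2 :: real) \<in> \<rat>" by simp
    ultimately show "z \<in> ring_of_integers (imag_quadratic_field d)"
      using algebraic_int_quad_order[OF z] unfolding ring_of_integers_def mem_imag_quadratic_field by blast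
  qed
  show "ring_of_integers (imag_quadratic_field d) \<subseteq> quad_order"
  proof
    fix z assume "z \<in> ring_of_integers (imag_quadratic_field d)"
    then obtain \<beta> where z: "algebraic_int z" "Re z \<in> \<rat>" "\<beta> \<in> \<rat>" "Im z = \<beta> * sqrt d"
      unfolding ring_of_integers_def mem_imag_quadratic_field by blast
    have cm: "(cmod z)^2 = (Re z)^2 + real d * \<beta>^2"
      using z(4) by (simp add: cmod_power2 power_mult_distrib)
    have "2 * Re z \<in> \<rat>" "(cmod z)^2 \<in> \<rat>" using z cm by simp_all
    then obtain \<tau> \<nu> where tn: "2 * Re z = of_int \<tau>" "(cmod z)^2 = of_int \<nu>"
      using algebraic_int_trace_norm[OF z(1)] by (metis Ints_cases)
    have eq: "(2 * Re z)^2 + real d * (2 * \<beta>)^2 = 4 * of_int \<nu>"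
      using cm tn(2) by (simp add: power_mult_distrib)
    then have "real d * (2 * \<beta>)^2 = of_int (4 * \<nu> - \<tau>^2)"
      unfolding tn(1) by simp
    then have "2 * \<beta> \<in> \<int>"
      using rat_square_times_prime_int[OF _ d, of "2 * \<beta>"] z(3) by (metis Ints_of_int Rats_mult Rats_number_of)
    then obtain \<eta> where eta: "2 * \<beta> = of_int \<eta>" by (rule Ints_cases)
    have "real_of_int (\<tau>^2 + int d * \<eta>^2) = of_int (4 * \<nu>)"
      using eq unfolding tn(1) eta by simp
    then have int_eq: "\<tau>^2 + int d * \<eta>^2 = 4 * \<nu>" unfolding of_int_eq_iff .
    show "z \<in> quad_order"
    proof (cases "t = 0")
      case True
      have "\<not> 4 dvd d"
      proof
        assume "4 dvd d"
        then have "2 dvd d" using dvd_trans[of 2 4 d] by simp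
        then have "d = 2" using d primes_dvd_imp_eq[of 2 d] by simp
        then show False using \<open>4 dvd d\<close> by simp
      qed
      then have "int d mod 4 = 1 \<or> int d mod 4 = 2" using tq True by presburger
      moreover have "(\<tau>^2 mod 4 + ((int d mod 4) * (\<eta>^2 mod 4)) mod 4) mod 4 = 0"
        using int_eq by (simp add: mod_simps)
      \<comment> \<open>For d congruent to 1 or 2 modulo 4, the residues 0 and 1 of the squares
        leave only the case that both are even.\<close>
      ultimately have "even \<tau> \<and> even \<eta>"
        unfolding int_square_mod_4 by (auto split: if_splits)
      then obtain x y where "\<tau> = 2 * x" "\<eta> = 2 * y" by blast
      then have "z = of_int x + of_int y * \<omega>"
        using tn(1) eta z(4) Im Re True by (simp add: complex_eq_iff)
      then show ?thesis unfolding quad_order_def by blast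
    next
      case False
      then have t: "t = 1" and d4: "int d = 4 * q - 1" using tq by auto
      have "\<tau>^2 + (4 * q - 1) * \<eta>^2 = 4 * \<nu>" using int_eq unfolding d4 .
      then have "\<tau>^2 = 4 * (\<nu> - q * \<eta>^2) + \<eta>^2" by (simp add: algebra_simps)
      then have "\<tau>^2 mod 4 = \<eta>^2 mod 4" by (simp only: mod_mult_self4)
      \<comment> \<open>For d congruent to -1 modulo 4, the congruence says only that \<tau> and
        \<eta> have equal parity.\<close>
      then have "even (\<tau> - \<eta>)" unfolding int_square_mod_4 by (auto split: if_splits)
      then obtain x where "\<tau> - \<eta> = 2 * x" by blast
      then have "\<tau> = 2 * x + \<eta>" by simp
      then have Re_z: "Re z = of_int x + of_int \<eta> / 2" using tn(1) by simp
      have "\<beta> = of_int \<eta> / 2" using eta by simp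
      then have Im_z: "Im z = of_int \<eta> * sqrt d / 2" using z(4) by simp
      have w: "Re \<omega> = 1 / 2" "Im \<omega> = sqrt d / 2" using Re Im t by simp_all
      have "z = of_int x + of_int \<eta> * \<omega>"
        by (simp add: complex_eq_iff Re_z Im_z w)
      then show ?thesis unfolding quad_order_def by blast
    qed
  qed
qed

end

section \<open>The integral over the circle\<close>

lemma borel_measurable_orthogonal_transformation:
  fixes f :: "'a :: euclidean_space \<Rightarrow> 'a"
  assumes "orthogonal_transformation f"
  shows "f \<in> borel_measurable borel"
  using orthogonal_transformation_linear[OF assms]
  by (intro borel_measurable_continuous_onI linear_continuous_on) (simp add: linear_conv_bounded_linear)

text \<open>Comparison on boxes suffices: the preimage of a box is its image under the inverse,
  which is orthogonal and preserves volume.\<close>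

lemma distr_lborel_orthogonal_transformation:
  fixes f :: "real ^ 'n :: {finite, wellorder} \<Rightarrow> real ^ 'n :: _"
  assumes f: "orthogonal_transformation f"
  shows "distr lborel borel f = lborel"
proof (rule lborel_eqI[symmetric])
  fix l u :: "real ^ 'n :: _" assume le: "\<And>b. b \<in> Basis \<Longrightarrow> l \<bullet> b \<le> u \<bullet> b"
  have m: "f \<in> borel_measurable borel" using f by (rule borel_measurable_orthogonal_transformation)
  have g: "orthogonal_transformation (inv f)" using f by (rule orthogonal_transformation_inv)
  have im: "f -` box l u = inv f ` box l u"
    using orthogonal_transformation_bij[OF f] by (rule bij_vimage_eq_inv_image)
  have "f -` box l u \<in> sets borel" using measurable_sets[OF m, of "box l u"] by simp
  then have "emeasure (distr lborel borel f) (box l u) = emeasure lebesgue (inv f ` box l u)"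
    using m by (simp add: emeasure_distr im)
  also have "\<dots> = ennreal (measure lebesgue (inv f ` box l u))"
    by (rule emeasure_eq_measure2[OF measurable_orthogonal_image[OF g lmeasurable_box]])
  also have "\<dots> = ennreal (measure lebesgue (box l u))"
    by (simp add: measure_orthogonal_image[OF g])
  also have "\<dots> = ennreal (\<Prod>b\<in>Basis. (u - l) \<bullet> b)"
    using le by (simp add: inner_diff_left)
  finally show "emeasure (distr lborel borel f) (box l u) = ennreal (\<Prod>b\<in>Basis. (u - l) \<bullet> b)" .
qed simp

text \<open>An orthogonal map commutes with radial projection, so the cone over a preimage is the
  preimage of the cone.\<close>

lemma surface_measure_orthogonal_invariant:
  fixes f :: "real ^ 'n :: {finite, wellorder} \<Rightarrow> real ^ 'n :: _"
  assumes f: "orthogonal_transformation f"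
  shows "distr (surface_measure r) borel f = surface_measure r"
proof (rule measure_eqI)
  fix A assume "A \<in> sets (distr (surface_measure r) borel f)"
  then have A [measurable]: "A \<in> sets borel" by simp
  have m [measurable]: "f \<in> borel_measurable borel" using f by (rule borel_measurable_orthogonal_transformation)
  have fA: "f -` A \<in> sets borel" using measurable_sets[OF m A] by simp
  define B where "B = {x \<in> ball 0 r - {0}. (r / norm x) *\<^sub>R x \<in> A}"
  have B: "B \<in> sets borel" unfolding B_def by measurable
  have "f x = 0 \<longleftrightarrow> x = 0" for x
    using orthogonal_transformation_norm[OF f, of x] by (metis norm_eq_zero)
  then have "{x \<in> ball 0 r - {0}. (r / norm x) *\<^sub>R x \<in> f -` A} = f -` B"
    using f by (auto simp: B_def orthogonal_transformation_norm orthogonal_transformation_linear linear_scale)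
  moreover have "emeasure lborel (f -` B) = emeasure lborel B"
    using emeasure_distr[of f lborel borel B] distr_lborel_orthogonal_transformation[OF f] B m by simp
  ultimately have "emeasure (surface_measure r) (f -` A) = emeasure (surface_measure r) A"
    by (simp add: emeasure_surface_measure fA A B_def)
  moreover have "f \<in> measurable (surface_measure r) borel" "space (surface_measure r :: (real ^ 'n :: _) measure) = UNIV"
    by (simp_all add: surface_measure_def space_scale_measure)
  ultimately show "emeasure (distr (surface_measure r) borel f) A = emeasure (surface_measure r) A"
    using A by (simp add: emeasure_distr)
qed (simp add: surface_measure_def)

text \<open>Substituting f maps the integral to its own negative. If h is not integrable, the
  integral is 0 by convention.\<close>

lemma sphere_integral_eq_0:
  fixes f :: "real ^ 'n :: {finite, wellorder} \<Rightarrow> real ^ 'n :: _" and h :: "real ^ 'n :: _ \<Rightarrow> real"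
  assumes f: "orthogonal_transformation f" and h: "h \<in> borel_measurable borel"
    and odd: "\<And>x. h (f x) = - h x"
  shows "(LINT x:sphere 0 r|surface_measure r. h x) = 0"
proof -
  let ?F = "\<lambda>x. indicator (sphere 0 r) x *\<^sub>R h x"
  have m: "f \<in> borel_measurable borel" using f by (rule borel_measurable_orthogonal_transformation)
  have "integral\<^sup>L (surface_measure r) ?F = integral\<^sup>L (distr (surface_measure r) borel f) ?F"
    by (simp only: surface_measure_orthogonal_invariant[OF f])
  also have "\<dots> = (LINT x|surface_measure r. ?F (f x))"
  proof (rule integral_distr)
    show "?F \<in> borel_measurable borel"
      by (intro borel_measurable_scaleR borel_measurable_indicator h) simp
  qed (use m in \<open>simp add: surface_measure_def\<close>)
  also have "\<dots> = (LINT x|surface_measure r. - ?F x)"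
    using orthogonal_transformation_norm[OF f] by (simp add: odd indicator_def)
  also have "\<dots> = - integral\<^sup>L (surface_measure r) ?F" by (rule integral_minus)
  finally show ?thesis by (simp add: set_lebesgue_integral_def)
qed

lemma polynomial_of_degree_le_square_diff:
  "polynomial_of_degree_le 2 (\<lambda>x :: real ^ 2. (x $ 1)^2 - (x $ 2)^2)"
proof -
  \<comment> \<open>\<open>e j\<close> is the exponent vector of the square of the j-th
    coordinate.\<close>
  define e :: "2 \<Rightarrow> 2 \<Rightarrow> nat" where "e = (\<lambda>j i. if i = j then 2 else 0)"
  let ?S = "{\<alpha> :: 2 \<Rightarrow> nat. (\<Sum>i\<in>UNIV. \<alpha> i) \<le> 2}"
  have e: "e j \<in> ?S" for j by (simp add: e_def)
  have sum: "(\<Sum>\<alpha>\<in>?S. of_bool (\<alpha> = e j) * (\<Prod>i\<in>UNIV. (x $ i) ^ \<alpha> i)) = (x $ j)^2" for j and x :: "real ^ 2"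
  proof -
    have "(\<Sum>\<alpha>\<in>?S. of_bool (\<alpha> = e j) * (\<Prod>i\<in>UNIV. (x $ i) ^ \<alpha> i))
        = (\<Sum>\<alpha>\<in>?S. if \<alpha> = e j then \<Prod>i\<in>UNIV. (x $ i) ^ \<alpha> i else 0)"
      by (intro sum.cong) auto
    also have "\<dots> = (\<Prod>i\<in>UNIV. (x $ i) ^ e j i)"
      using e[of j] by (simp add: finite_exponents)
    also have "\<dots> = (\<Prod>i\<in>UNIV. if i = j then (x $ i)^2 else 1)"
      by (intro prod.cong) (auto simp: e_def)
    also have "\<dots> = (x $ j)^2" by simp
    finally show ?thesis .
  qed
  show ?thesis
    unfolding polynomial_of_degree_le_def
  proof (intro exI allI)
    fix x :: "real ^ 2"
    show "(x $ 1)^2 - (x $ 2)^2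
      = (\<Sum>\<alpha>\<in>?S. (of_bool (\<alpha> = e 1) - of_bool (\<alpha> = e 2)) * (\<Prod>i\<in>UNIV. (x $ i) ^ \<alpha> i))"
      by (simp add: left_diff_distrib sum_subtractf sum)
  qed
qed

lemma spherical_design_2_square_sum:
  fixes X :: "(real ^ 2) set"
  assumes "spherical_design 2 X"
  shows "(\<Sum>x\<in>X. (x $ 1)^2 - (x $ 2)^2) = 0"
proof -
  \<comment> \<open>The quarter turn exchanges the two squares and thus changes the sign of the
    polynomial.\<close>
  define f :: "real ^ 2 \<Rightarrow> real ^ 2" where "f = (\<lambda>x. vector [- (x $ 2), x $ 1])"
  have "orthogonal_transformation f"
    unfolding orthogonal_transformation_def f_def
    by (auto intro!: linearI simp: vec_eq_iff forall_2 inner_vec_def sum_2)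
  moreover have "(\<lambda>x :: real ^ 2. (x $ 1)^2 - (x $ 2)^2) \<in> borel_measurable borel"
    by (intro borel_measurable_continuous_onI continuous_intros)
  ultimately have "(LINT x:sphere (0 :: real ^ 2) r|surface_measure r. (x $ 1)^2 - (x $ 2)^2) = 0" for r
    by (rule sphere_integral_eq_0) (simp add: f_def)
  then have "1 / real (card X) * (\<Sum>x\<in>X. (x $ 1)^2 - (x $ 2)^2) = 0"
    using assms polynomial_of_degree_le_square_diff unfolding spherical_design_def
    by (metis (mono_tags, lifting) mult_zero_right)
  moreover have "card X \<noteq> 0" using assms by (auto simp: spherical_design_def)
  ultimately show ?thesis by simp
qed

section \<open>Shells are not 2-designs\<close>

lemma not_spherical_design_2_shell:
  assumes "class_number_one_order t q"
    and ring: "ring_of_integers (imag_quadratic_field d) = imaginary_quadratic_order.quad_order t q"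
    and m: "m > 0" "shell (integer_lattice d) m \<noteq> {}"
  shows "\<not> spherical_design 2 (shell (integer_lattice d) m)"
proof
  assume design: "spherical_design 2 (shell (integer_lattice d) m)"
  interpret class_number_one_order t q by fact
  have inner: "complex_to_R2 z \<bullet> complex_to_R2 z = (cmod z)^2" for z
    by (simp add: complex_to_R2_def inner_vec_def sum_2 cmod_power2 flip: power2_eq_square)
  have shell: "shell (integer_lattice d) m = complex_to_R2 ` {z \<in> quad_order. (cmod z)^2 = m}"
    by (auto simp: shell_def integer_lattice_def ring inner)
  then obtain z where z: "z \<in> quad_order" "(cmod z)^2 = m" using m(2) by blast
  \<comment> \<open>A nonempty shell has a natural number as its m, since norms in the order are
    natural numbers.\<close>
  obtain n where "(cmod z)^2 = real n" using z(1) by (rule cmod_order_nat)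
  with z have n: "m = real n" "norm_shell n \<noteq> {}" by (auto simp: norm_shell_def)
  have image_shell: "shell (integer_lattice d) m = complex_to_R2 ` norm_shell n"
    using shell n(1) by (simp add: norm_shell_def)
  have "inj_on complex_to_R2 (norm_shell n)"
    by (auto intro!: inj_onI simp: complex_to_R2_def vec_eq_iff forall_2 complex_eq_iff)
  then have "(\<Sum>z\<in>norm_shell n. (Re z)^2 - (Im z)^2) = 0"
    using spherical_design_2_square_sum[OF design]
    unfolding image_shell by (simp add: sum.reindex) (simp add: complex_to_R2_def)
  then have "Re (square_sum n) = 0" by (simp add: square_sum_def power2_eq_square)
  \<comment> \<open>The design condition gives only the real part; the imaginary part vanishes
    because the shell is closed under conjugation.\<close>
  moreover have "cnj (square_sum n) = square_sum n"
  proof -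
    have "bij_betw cnj (norm_shell n) (norm_shell n)"
      by (rule bij_betw_byWitness[where f' = cnj]) (auto intro: norm_shell_cnj)
    then have "(\<Sum>z\<in>norm_shell n. (cnj z)^2) = square_sum n"
      unfolding square_sum_def by (rule sum.reindex_bij_betw)
    then show ?thesis by (simp add: square_sum_def)
  qed
  ultimately have "square_sum n = 0"
    by (simp add: complex_eq_iff)
  then show False using square_sum_ne_0 n m(1) by simp
qed

theorem theorem1p5:
  fixes d :: nat and m :: real
  assumes "d \<in> {2, 7, 11, 19, 43, 67, 163}"
    and "m > 0"
    and "shell (integer_lattice d) m \<noteq> {}"
  shows "\<not> spherical_design 2 (shell (integer_lattice d) m)"
proof -
  \<comment> \<open>Trace and norm of the generator: X^2 + 2 for d = 2, and X^2 - X + (d + 1) / 4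
    for the other d, which are all 3 modulo 4.\<close>
  define t :: int where "t = (if d = 2 then 0 else 1)"
  define q :: int where "q = (if d = 2 then 2 else (int d + 1) div 4)"
  have "(t, q) \<in> {(0, 2), (1, 2), (1, 3), (1, 5), (1, 11), (1, 17), (1, 41)}"
    using assms(1) by (auto simp: t_def q_def)
  then have order: "class_number_one_order t q" by (rule class_number_one_orderI)
  then interpret class_number_one_order t q .
  have "prime d" using assms(1) by auto
  moreover have "t = 0 \<and> q = int d \<and> d mod 4 \<noteq> 3 \<or> t = 1 \<and> 4 * q = int d + 1"
    using assms(1) by (auto simp: t_def q_def)
  ultimately have "ring_of_integers (imag_quadratic_field d) = quad_order"
    by (rule ring_of_integers_eq)
  then show ?thesis
    using order assms(2,3) not_spherical_design_2_shell by blast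
qed

end
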